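(* Let $\mathscr{A}$ be a $C^*$-algebra and let $\mathscr{E}$ be a right Hilbert $\mathscr{A}$-module admitting a conjugate-linear map $C:\mathscr{E}\to\mathscr{E}$ such that $C^2=I_{\mathscr{E}}$ and $\langle Cx,y\rangle=\langle x,Cy\rangle^*$ for all $x,y\in\mathscr{E}$. If $\mathscr{A}$ is commutative, then $C(xa)=C(x)a^*$ for every $x\in\mathscr{E}$ and $a\in\mathscr{A}$. Conversely, if $\mathscr{E}$ is full and $C(xa)=C(x)a^*$ holds for every $x\in\mathscr{E}$ and $a\in\mathscr{A}$, then $\mathscr{A}$ is commutative.
   Context: Inner products of right Hilbert $C^*$-modules are conjugate-linear in the first and linear in the second variable. $\mathscr{E}$ is full if the closed linear span of $\{\langle x,y\rangle:x,y\in\mathscr{E}\}$ equals $\mathscr{A}$. *)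

theory Defs
  imports "HOL-Analysis.Elementary_Topology"
begin

section \<open>Complex vector spaces and normed algebras\<close>

class complex_vector = real_vector +
  fixes scaleC :: "complex \<Rightarrow> 'a \<Rightarrow> 'a"  (infixr "*\<^sub>C" 75)
  assumes scaleC_add_right: "c *\<^sub>C (x + y) = c *\<^sub>C x + c *\<^sub>C y"
    and scaleC_add_left: "(c + d) *\<^sub>C x = c *\<^sub>C x + d *\<^sub>C x"
    and scaleC_scaleC: "c *\<^sub>C (d *\<^sub>C x) = (c * d) *\<^sub>C x"
    and scaleC_of_real: "complex_of_real r *\<^sub>C x = r *\<^sub>R x"

global_interpretation complex_vector:
  vector_space "scaleC :: complex \<Rightarrow> 'a \<Rightarrow> 'a::complex_vector"
  defines cspan = complex_vector.span
proof
  fix x :: 'a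
  show "1 *\<^sub>C x = x"
    using scaleC_of_real[of 1 x] by simp
qed (simp_all add: scaleC_add_right scaleC_add_left scaleC_scaleC)

class complex_normed_vector = complex_vector + real_normed_vector +
  assumes norm_scaleC: "norm (c *\<^sub>C x) = cmod c * norm x"

class complex_normed_algebra = complex_normed_vector + real_normed_algebra +
  assumes mult_scaleC_left: "(c *\<^sub>C x) * y = c *\<^sub>C (x * y)"
    and mult_scaleC_right: "x * (c *\<^sub>C y) = c *\<^sub>C (x * y)"

definition conjugate_linear :: "('a::complex_vector \<Rightarrow> 'b::complex_vector) \<Rightarrow> bool" where
  "conjugate_linear f \<longleftrightarrow>
     (\<forall>x y. f (x + y) = f x + f y) \<and> (\<forall>c x. f (c *\<^sub>C x) = cnj c *\<^sub>C f x)"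

section \<open>C*-algebras\<close>

text \<open>No unit is required, and the zero algebra is allowed.\<close>

class c_star_algebra = complex_normed_algebra + banach +
  fixes star :: "'a \<Rightarrow> 'a"
  assumes star_star: "star (star a) = a"
    and star_add: "star (a + b) = star a + star b"
    and star_scaleC: "star (c *\<^sub>C a) = cnj c *\<^sub>C star a"
    and star_mult: "star (a * b) = star b * star a"
    and norm_star_mult_self: "norm (star a * a) = (norm a)\<^sup>2"

definition positive_element :: "'a::c_star_algebra \<Rightarrow> bool" where
  "positive_element a \<longleftrightarrow> (\<exists>b. a = star b * b)"

section \<open>Right Hilbert modules\<close>

text \<open>
  The module carries the norm \<open>\<parallel>x\<parallel> = \<parallel>\<langle>x, x\<rangle>\<parallel>\<^sup>1\<^sup>/\<^sup>2\<close> (this is the assumption \<open>norm_eq\<close>),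
  so the sort constraint \<open>banach\<close> expresses completeness in that norm. Conjugate
  linearity of the inner product in the first variable follows from \<open>ip_star\<close> and the
  linearity in the second one.
\<close>

locale hilbert_module =
  fixes act :: "'e::{complex_normed_vector, banach} \<Rightarrow> 'a::c_star_algebra \<Rightarrow> 'e"
    and ip :: "'e \<Rightarrow> 'e \<Rightarrow> 'a"
  assumes act_add_left: "act (x + y) a = act x a + act y a"
    and act_add_right: "act x (a + b) = act x a + act x b"
    and act_mult: "act x (a * b) = act (act x a) b"
    and act_scaleC_left: "act (c *\<^sub>C x) a = c *\<^sub>C act x a"
    and act_scaleC_right: "act x (c *\<^sub>C a) = c *\<^sub>C act x a"
    and ip_add_right: "ip x (y + z) = ip x y + ip x z"
    and ip_scaleC_right: "ip x (c *\<^sub>C y) = c *\<^sub>C ip x y"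
    and ip_act_right: "ip x (act y a) = ip x y * a"
    and ip_star: "star (ip x y) = ip y x"
    and ip_positive: "positive_element (ip x x)"
    and ip_definite: "ip x x = 0 \<Longrightarrow> x = 0"
    and norm_eq: "norm x = sqrt (norm (ip x x))"

definition full :: "('e \<Rightarrow> 'e \<Rightarrow> 'a::c_star_algebra) \<Rightarrow> bool" where
  "full ip \<longleftrightarrow> closure (cspan {ip x y | x y. True}) = UNIV"

end

theory Submission imports Defs begin

text \<open>
  Both \<open>\<langle>C (x a), y\<rangle> = \<langle>C y, x\<rangle> a\<close> and \<open>\<langle>C (x) a\<^sup>*, y\<rangle> = a \<langle>C y, x\<rangle>\<close> hold without further
  hypotheses, so \<open>C (x a) = C (x) a\<^sup>*\<close> for all \<open>x\<close> says exactly that \<open>a\<close> commutes with every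
  \<open>\<langle>C y, x\<rangle>\<close>. Since \<open>C\<close> is onto, these are all the inner products, and the elements commuting
  with \<open>a\<close> form a closed subspace.
\<close>

text \<open>Multiplication by \<open>a\<close> on either side is continuous, so this is the set
  where two continuous maps agree.\<close>

lemma closed_centralizer: "closed {z :: 'a::real_normed_algebra. a * z = z * a}"
  by (intro closed_Collect_eq continuous_intros)

lemma commute_cspan:
  fixes a :: "'a::complex_normed_algebra"
  assumes "z \<in> cspan S" and "\<And>s. s \<in> S \<Longrightarrow> a * s = s * a"
  shows "a * z = z * a"
  using assms(1)
proof (induction rule: complex_vector.span_induct_alt)
  case base
  show ?case by simp
next
  case (step c x y)
  then show ?case
    by (simp add: assms(2) mult_scaleC_left mult_scaleC_right distrib_left distrib_right)
qed

lemma commute_of_full: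
  fixes ip :: "'e \<Rightarrow> 'e \<Rightarrow> 'a::c_star_algebra"
  assumes "full ip" and "\<And>x y. a * ip x y = ip x y * a"
  shows "a * b = b * a"
proof -
  have "cspan {ip x y | x y. True} \<subseteq> {z. a * z = z * a}"
    using assms(2) by (auto intro: commute_cspan)
  then have "closure (cspan {ip x y | x y. True}) \<subseteq> {z. a * z = z * a}"
    by (rule closure_minimal) (rule closed_centralizer)
  then show ?thesis
    using assms(1) by (auto simp: full_def)
qed

context hilbert_module
begin

lemma ip_act_left: "ip (act x a) y = star a * ip x y"
  by (metis ip_star ip_act_right star_mult)

text \<open>Nondegeneracy: \<open>u - v\<close> is orthogonal to every vector, hence to
  itself.\<close>

lemma ip_left_eqI:
  assumes "\<And>z. ip u z = ip v z"
  shows "u = v"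
proof -
  \<comment> \<open>The left side is \<open>ip z u\<close> by additivity, and taking
    \<open>star\<close> of the assumption turns it into \<open>ip z v\<close>.\<close>
  have "ip z v + ip z (u - v) = ip z v" for z
    using assms by (metis ip_add_right ip_star add.commute diff_add_cancel)
  then have "ip (u - v) (u - v) = 0"
    by simp
  then show ?thesis
    using ip_definite by fastforce
qed

lemma conjugation_act_iff:
  assumes "\<And>x y. ip (C x) y = star (ip x (C y))"
  shows "C (act x a) = act (C x) (star a) \<longleftrightarrow> (\<forall>y. a * ip (C y) x = ip (C y) x * a)"
proof -
  \<comment> \<open>The star swaps the arguments, so \<open>C\<close> can be moved from
    \<open>act x a\<close> onto \<open>y\<close>.\<close>
  have C: "ip (C x) y = ip (C y) x" for x y
    using assms ip_star by simp
  have "ip (C (act x a)) y = ip (C y) x * a"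
    and "ip (act (C x) (star a)) y = a * ip (C y) x" for y
    by (simp_all add: C[of _ y] ip_act_right ip_act_left star_star)
  then show ?thesis
    by (metis ip_left_eqI)
qed

end

theorem corollary6p2:
  fixes act :: "'e::{complex_normed_vector, banach} \<Rightarrow> 'a::c_star_algebra \<Rightarrow> 'e"
    and ip :: "'e \<Rightarrow> 'e \<Rightarrow> 'a"
    and C :: "'e \<Rightarrow> 'e"
  assumes "hilbert_module act ip"
    and "conjugate_linear C"
    and "C \<circ> C = id"
    and "\<forall>x y. ip (C x) y = star (ip x (C y))"
  shows "((\<forall>a b :: 'a. a * b = b * a) \<longrightarrow>
            (\<forall>x a. C (act x a) = act (C x) (star a))) \<and>
         (full ip \<and> (\<forall>x a. C (act x a) = act (C x) (star a)) \<longrightarrow>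
            (\<forall>a b :: 'a. a * b = b * a))"
proof -
  interpret hilbert_module act ip by fact
  have iff: "C (act x a) = act (C x) (star a) \<longleftrightarrow> (\<forall>y. a * ip (C y) x = ip (C y) x * a)" for x a
    using assms(4) by (intro conjugation_act_iff) simp
  have CC: "C (C y) = y" for y
    using assms(3) by (metis comp_apply id_apply)
  show ?thesis
  proof (intro conjI impI allI; (elim conjE)?)
    fix x a
    assume "\<forall>a b :: 'a. a * b = b * a"
    then show "C (act x a) = act (C x) (star a)"
      unfolding iff by blast
  next
    fix a b :: 'a
    assume full: "full ip" and "\<forall>x a. C (act x a) = act (C x) (star a)"
    \<comment> \<open>Apply \<open>iff\<close> with \<open>C y\<close> in place of \<open>y\<close>;
      as \<open>C (C y) = y\<close>, every inner product is reached.\<close>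
    then have "a * ip y x = ip y x * a" for x y
      using iff CC by metis
    with full show "a * b = b * a"
      by (rule commute_of_full)
  qed
qed

end
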